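(* Let $\mathcal P_n$ be the graded poset of lattice path matroids on $[n]$ ordered by the quotient relation $\leq_Q$. For each $z\in\{0,\dots,n\}$, the poset $\mathcal P_n$ has exactly $a(n+1,z+1)$ elements of rank $k=n-z$, where $a(m,r)=\frac1m\binom{m}{r}\binom{m}{r-1}$ are the Narayana numbers.
   Context: $[n]=\{1,\dots,n\}$. For $A,B\in\binom{[n]}{k}$ with $A=\{a_1<\dots<a_k\}$, $B=\{b_1<\dots<b_k\}$, $A\leq_G B$ (Gale order) iff $a_i\leq b_i$ for all $i$. For $0\leq k\leq n$ and $U\leq_G L$ in $\binom{[n]}{k}$, the lattice path matroid (LPM) $M[U,L]$ is the matroid of rank $k$ on $[n]$ with set of bases $\{B\in\binom{[n]}{k}: U\leq_G B\leq_G L\}$. For matroids $M,M'$ on $[n]$ with sets of bases $\mathcal B,\mathcal B'$, $M'\leq_Q M$ ($M'$ is a quotient of $M$) if for all $B\in\mathcal B$ and $p\in[n]\setminus B$ there is $B'\in\mathcal B'$ with $B'\subseteq B$ such that for all $q\in B'$: if $(B'\cup\{p\})\setminus\{q\}\in\mathcal B'$ then $(B\cup\{p\})\setminus\{q\}\in\mathcal B$. The poset $\mathcal P_n$ is graded with minimum $U_{0,n}$ and maximum $U_{n,n}$ (uniform matroids), and the rank of an element of $\mathcal P_n$ is its rank as a matroid. *)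

theory Defs
  imports Complex_Main "HOL-Library.Ramsey"
begin

text \<open>Matroids are presented by their ground set and their set of bases; the basis exchange
  axiom is not part of the record type. The only matroids used below are lattice path matroids,
  for which it is a known theorem.\<close>

record 'a matroid =
  ground :: "'a set"
  bases :: "'a set set"

text \<open>Two sets comparable in the Gale order have the same size, as \<open>list_all2\<close> forces equal
  lengths. The set \<open>[{1..n}]\<^bsup>k\<^esup>\<close> consists of the \<open>k\<close>-element subsets of \<open>{1..n}\<close>.\<close>

definition gale_le :: "nat set \<Rightarrow> nat set \<Rightarrow> bool"  (infix \<open>\<le>\<^sub>G\<close> 50) where
  "A \<le>\<^sub>G B \<longleftrightarrow> list_all2 (\<le>) (sorted_list_of_set A) (sorted_list_of_set B)"

definition lpm :: "nat \<Rightarrow> nat \<Rightarrow> nat set \<Rightarrow> nat set \<Rightarrow> nat matroid" where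
  "lpm n k U L = \<lparr>ground = {1..n}, bases = {B \<in> [{1..n}]\<^bsup>k\<^esup>. U \<le>\<^sub>G B \<and> B \<le>\<^sub>G L}\<rparr>"

definition LPMs :: "nat \<Rightarrow> nat matroid set" where
  "LPMs n = {lpm n k U L | k U L. k \<le> n \<and> U \<in> [{1..n}]\<^bsup>k\<^esup> \<and> L \<in> [{1..n}]\<^bsup>k\<^esup> \<and> U \<le>\<^sub>G L}"

definition quotient_le :: "'a matroid \<Rightarrow> 'a matroid \<Rightarrow> bool"  (infix \<open>\<le>\<^sub>Q\<close> 50) where
  "M' \<le>\<^sub>Q M \<longleftrightarrow> ground M' = ground M \<and>
     (\<forall>B \<in> bases M. \<forall>p \<in> ground M - B.
        \<exists>B' \<in> bases M'. B' \<subseteq> B \<and>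
          (\<forall>q \<in> B'. (B' \<union> {p}) - {q} \<in> bases M' \<longrightarrow> (B \<union> {p}) - {q} \<in> bases M))"

definition LPM_poset :: "nat \<Rightarrow> nat matroid rel" where
  "LPM_poset n = {(M', M). M' \<in> LPMs n \<and> M \<in> LPMs n \<and> M' \<le>\<^sub>Q M}"

text \<open>The rank of \<open>x\<close> in a finite graded poset with a minimum is the length (number of elements
  minus one) of a longest chain of elements below \<open>x\<close>, including \<open>x\<close> itself.
  In \<open>LPM_poset n\<close> this is the common size of the bases of \<open>x\<close>.\<close>

definition poset_rank :: "'a rel \<Rightarrow> 'a \<Rightarrow> nat" where
  "poset_rank r x = Max {card C | C. C \<in> Chains r \<and> (\<forall>y \<in> C. (y, x) \<in> r)} - 1"

definition narayana :: "nat \<Rightarrow> nat \<Rightarrow> rat" where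
  "narayana m r = 1 / of_nat m * of_nat (m choose r) * of_nat (m choose (r - 1))"

end

theory Submission
  imports Defs
begin

text \<open>The number of elements of a set that are at most \<open>j\<close>, as a function of \<open>j\<close>, describes the
  lattice path of the set, and \<open>A \<le>\<^sub>G B\<close> means that the sizes agree and the counts of \<open>A\<close> are
  pointwise at least those of \<open>B\<close> (\<open>dominates A B\<close>).

  The poset rank of a lattice path matroid \<open>M\<close> is the size \<open>k\<close> of its bases. The quotient relation
  is transitive straight from its definition, and deleting the largest element of each end of
  \<open>M\<close> gives a lattice path matroid of rank \<open>k - 1\<close> that is a quotient of \<open>M\<close>
  (\<open>remove_Max_quotient\<close>); iterating this gives a chain of \<open>k + 1\<close> elements below \<open>M\<close>. No chain
  is longer, since a quotient has at most the rank of \<open>M\<close>, and a quotient of the same rank is \<open>M\<close>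
  itself (\<open>same_rank_quotient_eq\<close>).

  The two ends of a lattice path matroid are its extreme bases, so the matroids of rank \<open>k\<close>
  correspond to the pairs of \<open>k\<close>-sets comparable in the Gale order. Deciding for both sets whether
  they contain the last element of the ground set gives a four-term recursion for the number of
  such pairs, allowing different sizes \<open>a\<close> and \<open>b\<close>. Its solution is the determinant
  \<open>C(n,a) C(n,b) - C(n,a+1) C(n,b-1)\<close> (\<open>card_dominated_pairs\<close>), which for \<open>a = b = k\<close> is the
  Narayana number.\<close>

section \<open>The Gale order through prefix counts\<close>

definition prefix_card :: "nat set \<Rightarrow> nat \<Rightarrow> nat" where
  "prefix_card A j = card (A \<inter> {..j})"

definition dominates :: "nat set \<Rightarrow> nat set \<Rightarrow> bool" where
  "dominates A B \<longleftrightarrow> (\<forall>j. prefix_card B j \<le> prefix_card A j)"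

lemma dominates_refl: "dominates A A"
  by (simp add: dominates_def)

lemma dominates_trans: "dominates A B \<Longrightarrow> dominates B C \<Longrightarrow> dominates A C"
  unfolding dominates_def by (meson le_trans)

lemma prefix_card_le_card: "finite A \<Longrightarrow> prefix_card A j \<le> card A"
  by (simp add: prefix_card_def card_mono)

lemma prefix_card_eq_card: "A \<subseteq> {..j} \<Longrightarrow> prefix_card A j = card A"
  by (simp add: prefix_card_def inf_absorb1)

lemma prefix_card_insert:
  assumes "finite A" "x \<notin> A"
  shows "prefix_card (insert x A) j = prefix_card A j + of_bool (x \<le> j)"
  using assms by (auto simp: prefix_card_def Int_insert_left)

lemma prefix_card_remove:
  assumes "finite A" "x \<in> A"
  shows "prefix_card A j = prefix_card (A - {x}) j + of_bool (x \<le> j)"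
  using prefix_card_insert[of "A - {x}" x j] assms by (simp add: insert_absorb)

lemma length_filter_le_iff_nth:
  fixes xs :: "nat list"
  assumes "sorted xs"
  shows "i < length (filter (\<lambda>x. x \<le> j) xs) \<longleftrightarrow> i < length xs \<and> xs ! i \<le> j"
  using assms
proof (induction xs arbitrary: i)
  case (Cons x xs)
  show ?case
  proof (cases "x \<le> j")
    case True
    then show ?thesis using Cons by (cases i) auto
  next
    case False
    then have "filter (\<lambda>x. x \<le> j) xs = []"
      using Cons.prems by (auto simp: filter_empty_conv)
    moreover have "\<not> (x # xs) ! i \<le> j" if "i < length (x # xs)"
      using that False Cons.prems by (cases i) (auto dest!: bspec[OF _ nth_mem])
    ultimately show ?thesis using False by auto
  qed
qed simp

lemma less_prefix_card_iff_nth: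
  assumes "finite A"
  shows "i < prefix_card A j \<longleftrightarrow> i < card A \<and> sorted_list_of_set A ! i \<le> j"
proof -
  have "prefix_card A j = length (filter (\<lambda>x. x \<le> j) (sorted_list_of_set A))"
  proof -
    have "A \<inter> {..j} = set (filter (\<lambda>x. x \<le> j) (sorted_list_of_set A))"
      using assms by auto
    then show ?thesis
      by (simp add: prefix_card_def distinct_card del: set_filter)
  qed
  then show ?thesis
    using assms by (simp add: length_filter_le_iff_nth)
qed

text \<open>The \<open>i\<close>-th smallest element of a set is at most \<open>j\<close> exactly if more than \<open>i\<close> elements
  (counting \<open>i\<close> from 0) are at most \<open>j\<close>. So prefix counts carry the same information as the sorted
  list, but they respond to adding or removing an element by a simple formula, which the positions
  in the sorted list do not.\<close>

lemma gale_le_iff_dominates: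
  assumes "finite A" "finite B"
  shows "A \<le>\<^sub>G B \<longleftrightarrow> card A = card B \<and> dominates A B"
proof -
  have "(\<forall>i<card A. sorted_list_of_set A ! i \<le> sorted_list_of_set B ! i) \<longleftrightarrow> dominates A B"
    if "card A = card B"
  proof -
    have "dominates A B \<longleftrightarrow> (\<forall>i j. i < prefix_card B j \<longrightarrow> i < prefix_card A j)"
      unfolding dominates_def using not_le by (auto intro: less_le_trans)
    also have "\<dots> \<longleftrightarrow> (\<forall>i j. i < card A \<longrightarrow> sorted_list_of_set B ! i \<le> j
        \<longrightarrow> sorted_list_of_set A ! i \<le> j)"
      using assms that by (auto simp: less_prefix_card_iff_nth)
    also have "\<dots> \<longleftrightarrow> (\<forall>i<card A. sorted_list_of_set A ! i \<le> sorted_list_of_set B ! i)"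
      by (blast intro: le_trans)
    finally show ?thesis by simp
  qed
  then show ?thesis
    using assms by (auto simp: gale_le_def list_all2_conv_all_nth)
qed

text \<open>The smallest element \<open>q\<close> of \<open>B - A\<close> is the right one to trade: up to \<open>q\<close> all of \<open>B\<close> lies
  in \<open>A\<close>, so counting up to \<open>q\<close> produces an element \<open>p < q\<close> of \<open>A - B\<close>, and the prefix counts
  of \<open>A\<close> and \<open>B\<close> differ strictly between \<open>p\<close> and \<open>q\<close>. Replacing \<open>q\<close> by \<open>p\<close> in \<open>B\<close>, or \<open>p\<close> by
  \<open>q\<close> in \<open>A\<close>, changes the counts by one on just this range, and the new set remains between \<open>A\<close>
  and \<open>B\<close>.\<close>

lemma dominates_exchange:
  assumes fin: "finite A" "finite B" and card: "card A = card B"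
    and dom: "dominates A B" and neq: "A \<noteq> B"
  obtains p q where "p \<in> A - B" "q \<in> B - A" "p < q"
    "dominates A (B \<union> {p} - {q})" "dominates (A \<union> {q} - {p}) B"
proof -
  have "B - A \<noteq> {}"
    using fin card neq by (metis Diff_eq_empty_iff card_subset_eq)
  define q where "q = Min (B - A)"
  have q: "q \<in> B - A"
    unfolding q_def using fin \<open>B - A \<noteq> {}\<close> by (intro Min_in) auto
  have below_q: "x \<in> A" if "x \<in> B" "x < q" for x
    using that fin Min_le[of "B - A" x] unfolding q_def by fastforce
  have "\<not> A \<inter> {..q} \<subset> B \<inter> {..q}"
    using dom fin psubset_card_mono[of "B \<inter> {..q}" "A \<inter> {..q}"]
    unfolding dominates_def prefix_card_def by (meson finite_Int leD)
  then obtain p where p: "p \<in> A - B" "p \<le> q"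
    using q by auto
  with q have "p < q" by (metis DiffD1 DiffD2 le_neq_implies_less)
  have strict: "prefix_card B j < prefix_card A j" if "p \<le> j" "j < q" for j
    unfolding prefix_card_def
  proof (rule psubset_card_mono)
    show "B \<inter> {..j} \<subset> A \<inter> {..j}" using p below_q that by auto
  qed (use fin in auto)
  have le: "prefix_card B j \<le> prefix_card A j" for j
    using dom by (simp add: dominates_def)
  have "prefix_card (B \<union> {p} - {q}) j \<le> prefix_card A j" for j
  proof -
    have "prefix_card (B \<union> {p}) j = prefix_card B j + of_bool (p \<le> j)"
      using prefix_card_insert[of B p j] fin p by simp
    moreover have "prefix_card (B \<union> {p}) j = prefix_card (B \<union> {p} - {q}) j + of_bool (q \<le> j)"
      using fin q by (intro prefix_card_remove) auto
    ultimately show ?thesis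
      using strict[of j] le[of j] \<open>p < q\<close> by (auto simp: of_bool_def split: if_splits)
  qed
  moreover have "prefix_card B j \<le> prefix_card (A \<union> {q} - {p}) j" for j
  proof -
    have "prefix_card (A \<union> {q}) j = prefix_card A j + of_bool (q \<le> j)"
      using prefix_card_insert[of A q j] fin q by simp
    moreover have "prefix_card (A \<union> {q}) j = prefix_card (A \<union> {q} - {p}) j + of_bool (p \<le> j)"
      using fin p by (intro prefix_card_remove) auto
    ultimately show ?thesis
      using strict[of j] le[of j] \<open>p < q\<close> by (auto simp: of_bool_def split: if_splits)
  qed
  ultimately show ?thesis
    using that p q \<open>p < q\<close> by (simp add: dominates_def)
qed

lemma dominates_antisym:
  assumes "finite A" "finite B" "card A = card B" "dominates A B" "dominates B A"
  shows "A = B"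
proof (rule ccontr)
  assume "A \<noteq> B"
  then obtain p q where pq: "p \<in> A - B" "q \<in> B - A" "p < q" "dominates A (B \<union> {p} - {q})"
    using dominates_exchange assms by metis
  have "prefix_card (B \<union> {p}) p = prefix_card B p + 1"
    using prefix_card_insert[of B p p] assms pq by simp
  moreover have "prefix_card (B \<union> {p}) p = prefix_card (B \<union> {p} - {q}) p"
    using prefix_card_remove[of "B \<union> {p}" q p] assms pq by simp
  ultimately have "prefix_card B p < prefix_card A p"
    using pq(4) by (metis dominates_def less_add_one order_less_le_trans)
  then show False using assms(5) by (meson dominates_def leD)
qed

section \<open>Lattice path matroids and their quotients\<close>

definition gale_pairs :: "nat \<Rightarrow> nat \<Rightarrow> (nat set \<times> nat set) set" where
  "gale_pairs n k = {(U, L). U \<in> [{1..n}]\<^bsup>k\<^esup> \<and> L \<in> [{1..n}]\<^bsup>k\<^esup> \<and> U \<le>\<^sub>G L}"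

lemma gale_pairs_iff:
  "(U, L) \<in> gale_pairs n k \<longleftrightarrow> U \<in> [{1..n}]\<^bsup>k\<^esup> \<and> L \<in> [{1..n}]\<^bsup>k\<^esup> \<and> dominates U L"
  by (auto simp: gale_pairs_def nsets_def gale_le_iff_dominates)

lemma rank_le_if_gale_pairs: "(U, L) \<in> gale_pairs n k \<Longrightarrow> k \<le> n"
  using card_mono[of "{1..n}" U] by (auto simp: gale_pairs_def nsets_def)

lemma LPMs_eq: "LPMs n = {lpm n k U L | k U L. (U, L) \<in> gale_pairs n k}"
proof -
  have "k \<le> n \<and> U \<in> [{1..n}]\<^bsup>k\<^esup> \<and> L \<in> [{1..n}]\<^bsup>k\<^esup> \<and> U \<le>\<^sub>G L \<longleftrightarrow>
      (U, L) \<in> gale_pairs n k" for k U L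
    using rank_le_if_gale_pairs[of U L n k] by (auto simp: gale_pairs_def)
  then show ?thesis by (simp add: LPMs_def)
qed

lemma ground_lpm [simp]: "ground (lpm n k U L) = {1..n}"
  by (simp add: lpm_def)

lemma base_lpm_iff:
  assumes "(U, L) \<in> gale_pairs n k"
  shows "B \<in> bases (lpm n k U L) \<longleftrightarrow> B \<in> [{1..n}]\<^bsup>k\<^esup> \<and> dominates U B \<and> dominates B L"
  using assms by (auto simp: lpm_def gale_pairs_iff nsets_def gale_le_iff_dominates)

lemma ends_are_bases:
  assumes "(U, L) \<in> gale_pairs n k"
  shows "U \<in> bases (lpm n k U L)" "L \<in> bases (lpm n k U L)"
  using assms base_lpm_iff[OF assms] by (auto simp: gale_pairs_iff dominates_refl)

lemma base_card: "B \<in> bases (lpm n k U L) \<Longrightarrow> B \<subseteq> {1..n} \<and> finite B \<and> card B = k"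
  by (auto simp: lpm_def nsets_def)

lemma ends_eq_if_bases_eq:
  assumes "(U, L) \<in> gale_pairs n k" "(U', L') \<in> gale_pairs n k"
    and eq: "bases (lpm n k U L) = bases (lpm n k U' L')"
  shows "U = U'" "L = L'"
proof -
  have fin: "finite U" "finite U'" "finite L" "finite L'"
      "card U = card U'" "card L = card L'"
    using assms by (auto simp: gale_pairs_def nsets_def)
  have "dominates U U'" "dominates L' L" "dominates U' U" "dominates L L'"
    using base_lpm_iff[OF assms(1)] base_lpm_iff[OF assms(2)]
      ends_are_bases[OF assms(1)] ends_are_bases[OF assms(2)] eq by auto
  then show "U = U'" "L = L'"
    using dominates_antisym fin by auto
qed

lemma quotient_leE:
  assumes "M' \<le>\<^sub>Q M" "B \<in> bases M" "p \<in> ground M - B"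
  obtains B' where "B' \<in> bases M'" "B' \<subseteq> B"
    "\<forall>q\<in>B'. B' \<union> {p} - {q} \<in> bases M' \<longrightarrow> B \<union> {p} - {q} \<in> bases M"
proof -
  have "\<exists>B'\<in>bases M'. B' \<subseteq> B \<and>
      (\<forall>q\<in>B'. B' \<union> {p} - {q} \<in> bases M' \<longrightarrow> B \<union> {p} - {q} \<in> bases M)"
    using assms unfolding quotient_le_def by meson
  then show thesis using that by (elim bexE conjE)
qed

lemma quotient_le_refl: "M \<le>\<^sub>Q M"
  unfolding quotient_le_def by blast

lemma quotient_le_trans:
  assumes "M1 \<le>\<^sub>Q M2" "M2 \<le>\<^sub>Q M3"
  shows "M1 \<le>\<^sub>Q M3"
  unfolding quotient_le_def
proof (intro conjI ballI)
  show "ground M1 = ground M3"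
    using assms by (simp add: quotient_le_def)
next
  fix B p assume B: "B \<in> bases M3" and p: "p \<in> ground M3 - B"
  obtain B2 where B2: "B2 \<in> bases M2" "B2 \<subseteq> B"
      "\<forall>q\<in>B2. B2 \<union> {p} - {q} \<in> bases M2 \<longrightarrow> B \<union> {p} - {q} \<in> bases M3"
    using quotient_leE[OF assms(2) B p] .
  moreover have "p \<in> ground M2 - B2"
    using assms(2) B2(2) p by (auto simp: quotient_le_def)
  ultimately obtain B1 where "B1 \<in> bases M1" "B1 \<subseteq> B2"
      "\<forall>q\<in>B1. B1 \<union> {p} - {q} \<in> bases M1 \<longrightarrow> B2 \<union> {p} - {q} \<in> bases M2"
    using quotient_leE[OF assms(1)] by metis
  with B2 show "\<exists>B'\<in>bases M1. B' \<subseteq> B \<and>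
      (\<forall>q\<in>B'. B' \<union> {p} - {q} \<in> bases M1 \<longrightarrow> B \<union> {p} - {q} \<in> bases M3)"
    by (intro bexI[of _ B1]) auto
qed

lemma quotient_rank_le:
  assumes "(U', L') \<in> gale_pairs n k'" "(U, L) \<in> gale_pairs n k"
    and "lpm n k' U' L' \<le>\<^sub>Q lpm n k U L"
  shows "k' \<le> k"
proof (cases "\<exists>p. p \<in> {1..n} - U")
  case True
  then obtain B' where "B' \<in> bases (lpm n k' U' L')" "B' \<subseteq> U"
    using quotient_leE[OF assms(3) ends_are_bases(1)[OF assms(2)]] True unfolding ground_lpm by metis
  then show ?thesis
    using base_card[OF ends_are_bases(1)[OF assms(2)]] base_card card_mono by metis
next
  \<comment> \<open>The quotient condition says nothing about a base that fills the ground set, but then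
    \<open>k = n\<close>.\<close>
  case False
  then have "{1..n} \<subseteq> U" by blast
  then have "k = n"
    using base_card[OF ends_are_bases(1)[OF assms(2)]] by (metis antisym card_atLeastAtMost diff_Suc_1)
  then show ?thesis using rank_le_if_gale_pairs[OF assms(1)] by simp
qed

text \<open>If the ranks agree and are less than \<open>n\<close>, the subset \<open>B'\<close> of \<open>B\<close> in the quotient condition
  must be \<open>B\<close> itself. So the bases of \<open>M\<close> are bases of \<open>M'\<close>, and they are closed under the single exchanges that
  stay inside \<open>M'\<close>. Were the lower end \<open>U\<close> of \<open>M\<close> not the lower end of \<open>M'\<close>, an exchange inside
  \<open>M'\<close> would push it further down and out of \<open>M\<close>; similarly for the upper end.\<close>

lemma same_rank_quotient_eq:
  assumes P': "(U', L') \<in> gale_pairs n k" and P: "(U, L) \<in> gale_pairs n k"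
    and quot: "lpm n k U' L' \<le>\<^sub>Q lpm n k U L"
  shows "lpm n k U' L' = lpm n k U L"
proof (cases "k = n")
  case True
  have "X = {1..n}" if "X \<in> [{1..n}]\<^bsup>n\<^esup>" for X
    using that by (intro card_subset_eq) (auto simp: nsets_def)
  then show ?thesis using P P' True by (auto simp: gale_pairs_iff)
next
  case False
  let ?M' = "lpm n k U' L'" and ?M = "lpm n k U L"
  have fin: "finite U" "finite L" "finite U'" "finite L'"
    and card: "card U = k" "card L = k" "card U' = k" "card L' = k"
    and sub: "U \<subseteq> {1..n}" "L \<subseteq> {1..n}" "U' \<subseteq> {1..n}" "L' \<subseteq> {1..n}"
    using P P' by (auto simp: gale_pairs_def nsets_def)
  have step: "B \<in> bases ?M' \<and> (\<forall>q\<in>B. B \<union> {p} - {q} \<in> bases ?M' \<longrightarrow> B \<union> {p} - {q} \<in> bases ?M)"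
    if Bp: "B \<in> bases ?M" "p \<in> {1..n} - B" for B p
  proof -
    obtain B' where B': "B' \<in> bases ?M'" "B' \<subseteq> B"
        "\<forall>q\<in>B'. B' \<union> {p} - {q} \<in> bases ?M' \<longrightarrow> B \<union> {p} - {q} \<in> bases ?M"
      using quotient_leE[OF quot Bp(1)] Bp(2) unfolding ground_lpm by blast
    then have "B' = B"
      using base_card Bp(1) by (metis card_subset_eq)
    with B' show ?thesis by simp
  qed
  \<comment> \<open>As \<open>k < n\<close>, every base has a complement to take \<open>p\<close> from.\<close>
  have base_sub: "B \<in> bases ?M'" if "B \<in> bases ?M" for B
  proof -
    have "{1..n} - B \<noteq> {}"
      using base_card[OF that] False card_mono[of B "{1..n}"] by fastforce
    then show ?thesis using step that by blast
  qed
  have exchange: "X \<union> {p} - {q} \<in> [{1..n}]\<^bsup>k\<^esup>"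
    if "X \<subseteq> {1..n}" "finite X" "card X = k" "p \<in> {1..n} - X" "q \<in> X" for X p q
    using that by (auto simp: nsets_def card_insert_if)
  have dom: "dominates U' U" "dominates U L'" "dominates U' L" "dominates L L'"
    using base_sub[OF ends_are_bases(1)[OF P]] base_sub[OF ends_are_bases(2)[OF P]]
      base_lpm_iff[OF P'] by auto
  have "U = U'"
  proof (rule ccontr)
    assume "U \<noteq> U'"
    then obtain p q where pq: "p \<in> U' - U" "q \<in> U - U'" "p < q" "dominates U' (U \<union> {p} - {q})"
      using dominates_exchange[of U' U] fin card dom by metis
    let ?X = "U \<union> {p} - {q}"
    have count: "prefix_card ?X j + of_bool (q \<le> j) = prefix_card U j + of_bool (p \<le> j)" for j
      using prefix_card_insert[of U p j] prefix_card_remove[of "U \<union> {p}" q j] fin pq by simp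
    have "dominates ?X U"
      unfolding dominates_def
    proof
      fix j show "prefix_card U j \<le> prefix_card ?X j"
        using count[of j] pq(3) by (auto simp: of_bool_def split: if_splits)
    qed
    moreover have "?X \<in> [{1..n}]\<^bsup>k\<^esup>"
      using exchange pq sub fin card by blast
    ultimately have "?X \<in> bases ?M'"
      using base_lpm_iff[OF P'] pq(4) dom(2) dominates_trans by blast
    then have "?X \<in> bases ?M"
      using step[OF ends_are_bases(1)[OF P], of p] pq sub by blast
    then have "dominates U ?X"
      using base_lpm_iff[OF P] by blast
    then have "prefix_card ?X p \<le> prefix_card U p"
      by (simp add: dominates_def)
    then show False using count[of p] pq(3) by simp
  qed
  moreover have "L = L'"
  proof (rule ccontr)
    assume "L \<noteq> L'"
    then obtain p q where pq: "p \<in> L - L'" "q \<in> L' - L" "p < q" "dominates (L \<union> {q} - {p}) L'"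
      using dominates_exchange[of L L'] fin card dom by metis
    let ?X = "L \<union> {q} - {p}"
    have count: "prefix_card ?X j + of_bool (p \<le> j) = prefix_card L j + of_bool (q \<le> j)" for j
      using prefix_card_insert[of L q j] prefix_card_remove[of "L \<union> {q}" p j] fin pq by simp
    have "dominates L ?X"
      unfolding dominates_def
    proof
      fix j show "prefix_card ?X j \<le> prefix_card L j"
        using count[of j] pq(3) by (auto simp: of_bool_def split: if_splits)
    qed
    moreover have "?X \<in> [{1..n}]\<^bsup>k\<^esup>"
      using exchange pq sub fin card by blast
    ultimately have "?X \<in> bases ?M'"
      using base_lpm_iff[OF P'] pq(4) dom(3) dominates_trans by blast
    then have "?X \<in> bases ?M"
      using step[OF ends_are_bases(2)[OF P], of q] pq sub by blast
    then have "dominates ?X L"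
      using base_lpm_iff[OF P] by blast
    then have "prefix_card L p \<le> prefix_card ?X p"
      by (simp add: dominates_def)
    then show False using count[of p] pq(3) by simp
  qed
  ultimately show ?thesis by simp
qed

lemma prefix_card_remove_Max:
  assumes "finite A" "card A = Suc k"
  shows "prefix_card (A - {Max A}) j = min (prefix_card A j) k"
proof -
  have "A \<noteq> {}" using assms by auto
  then have Max: "Max A \<in> A" "\<And>x. x \<in> A \<Longrightarrow> x \<le> Max A"
    using assms by auto
  have remove: "prefix_card A j = prefix_card (A - {Max A}) j + of_bool (Max A \<le> j)"
    using prefix_card_remove assms Max by blast
  have le: "prefix_card (A - {Max A}) j \<le> k"
    using prefix_card_le_card[of "A - {Max A}" j] assms Max by simp
  show ?thesis
  proof (cases "Max A \<le> j")
    case True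
    then have "A \<subseteq> {..j}" using Max(2) le_trans by fastforce
    then have "prefix_card A j = Suc k" using assms by (simp add: prefix_card_eq_card)
    then show ?thesis using remove True by simp
  next
    case False
    then show ?thesis using remove le by simp
  qed
qed

lemma dominates_remove_Max:
  assumes "finite A" "finite B" "card A = Suc k" "card B = Suc k" "dominates A B"
  shows "dominates (A - {Max A}) (B - {Max B})"
  using assms by (simp add: dominates_def prefix_card_remove_Max min.coboundedI1)

text \<open>Deleting the largest element caps the prefix counts at \<open>k\<close>, hence preserves domination, and
  so \<open>B\<close> without its maximum \<open>m\<close> is a base of the smaller matroid. If an exchange of \<open>q\<close> for \<open>p\<close>
  there gives a base \<open>X\<close>, adding \<open>m\<close> back to \<open>X\<close> obeys the bounds of the larger matroid: the cap
  makes a difference only where all of \<open>L\<close> has been counted, and there \<open>m\<close> has been counted too,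
  since \<open>B\<close> dominates \<open>L\<close>; and where \<open>m\<close> contributes, the count of \<open>U\<close>, which is at least that
  of \<open>B\<close>, is already full.\<close>

lemma remove_Max_quotient:
  assumes P: "(U, L) \<in> gale_pairs n (Suc k)"
  shows "(U - {Max U}, L - {Max L}) \<in> gale_pairs n k"
    and "lpm n k (U - {Max U}) (L - {Max L}) \<le>\<^sub>Q lpm n (Suc k) U L"
proof -
  let ?U = "U - {Max U}" and ?L = "L - {Max L}"
  have fin: "finite U" "finite L" and card: "card U = Suc k" "card L = Suc k"
    and dom: "dominates U L"
    using P by (auto simp: gale_pairs_iff nsets_def)
  have remove_in: "X - {Max X} \<in> [{1..n}]\<^bsup>k\<^esup>" if "X \<in> [{1..n}]\<^bsup>Suc k\<^esup>" for X
    using that Max_in[of X] by (fastforce simp: nsets_def)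
  show P': "(?U, ?L) \<in> gale_pairs n k"
    using P remove_in dominates_remove_Max[OF fin card dom] by (simp add: gale_pairs_iff)
  show "lpm n k ?U ?L \<le>\<^sub>Q lpm n (Suc k) U L"
    unfolding quotient_le_def ground_lpm
  proof (intro conjI ballI)
    fix B p assume B: "B \<in> bases (lpm n (Suc k) U L)" and p: "p \<in> {1..n} - B"
    have finB: "finite B" "card B = Suc k" "B \<subseteq> {1..n}"
      using base_card B by auto
    then have "B \<noteq> {}" by auto
    define m where "m = Max B"
    have m: "m \<in> B" "\<And>x. x \<in> B \<Longrightarrow> x \<le> m"
      using finB \<open>B \<noteq> {}\<close> by (auto simp: m_def)
    have domB: "dominates U B" "dominates B L"
      using B base_lpm_iff[OF P] by auto
    have B': "B - {m} \<in> bases (lpm n k ?U ?L)"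
      using remove_in[of B] B base_lpm_iff[OF P] base_lpm_iff[OF P'] fin card finB domB
      by (simp add: dominates_remove_Max m_def)
    have "B \<union> {p} - {q} \<in> bases (lpm n (Suc k) U L)"
      if q: "q \<in> B - {m}" and X: "B - {m} \<union> {p} - {q} \<in> bases (lpm n k ?U ?L)" for q
    proof -
      let ?X = "B - {m} \<union> {p} - {q}"
      have eq: "B \<union> {p} - {q} = insert m ?X" and "m \<notin> ?X"
        using m q p by auto
      have finX: "finite ?X" using finB by simp
      have count: "prefix_card (insert m ?X) j = prefix_card ?X j + of_bool (m \<le> j)" for j
        using prefix_card_insert[OF finX \<open>m \<notin> ?X\<close>] .
      have Xdom: "prefix_card ?X j \<le> min (prefix_card U j) k"
          "min (prefix_card L j) k \<le> prefix_card ?X j" for j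
        using X base_lpm_iff[OF P'] prefix_card_remove_Max fin card
        by (auto simp: dominates_def)
      have "dominates U (insert m ?X)"
        unfolding dominates_def
      proof
        fix j
        show "prefix_card (insert m ?X) j \<le> prefix_card U j"
        proof (cases "m \<le> j")
          case True
          then have "B \<subseteq> {..j}" using m(2) le_trans by fastforce
          then have "prefix_card B j = Suc k" using finB by (simp add: prefix_card_eq_card)
          then have "Suc k \<le> prefix_card U j"
            using domB(1) by (metis dominates_def)
          then show ?thesis using Xdom(1)[of j] count[of j] True by simp
        next
          case False
          then show ?thesis using Xdom(1)[of j] count[of j] by simp
        qed
      qed
      moreover have "dominates (insert m ?X) L"
        unfolding dominates_def
      proof
        fix j
        have L: "prefix_card L j \<le> Suc k"
          using prefix_card_le_card fin card by metis
        show "prefix_card L j \<le> prefix_card (insert m ?X) j"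
        proof (cases "m \<le> j")
          case True
          then show ?thesis using Xdom(2)[of j] count[of j] L by simp
        next
          case False
          then have "prefix_card B j = prefix_card (B - {m}) j"
            using prefix_card_remove[OF finB(1) m(1)] by simp
          also have "\<dots> \<le> k"
            using prefix_card_le_card[of "B - {m}" j] finB m by simp
          finally have "prefix_card L j \<le> k"
            using domB(2) by (meson dominates_def le_trans)
          then show ?thesis using Xdom(2)[of j] count[of j] by simp
        qed
      qed
      moreover have "B \<union> {p} - {q} \<in> [{1..n}]\<^bsup>Suc k\<^esup>"
        using finB p q by (auto simp: nsets_def card_insert_if)
      ultimately show ?thesis
        using base_lpm_iff[OF P] eq by simp
    qed
    then show "\<exists>B'\<in>bases (lpm n k ?U ?L). B' \<subseteq> B \<and> (\<forall>q\<in>B'.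
        B' \<union> {p} - {q} \<in> bases (lpm n k ?U ?L) \<longrightarrow> B \<union> {p} - {q} \<in> bases (lpm n (Suc k) U L))"
      using B' by blast
  qed simp
qed

section \<open>The rank function of the poset\<close>

lemma maximal_chain_below:
  assumes "(U, L) \<in> gale_pairs n k"
  shows "\<exists>C \<in> Chains (LPM_poset n). (\<forall>M\<in>C. (M, lpm n k U L) \<in> LPM_poset n) \<and> finite C \<and>
    card C = Suc k"
  using assms
proof (induction k arbitrary: U L)
  case 0
  let ?M = "lpm n 0 U L"
  have "(?M, ?M) \<in> LPM_poset n"
    using 0 quotient_le_refl by (auto simp: LPM_poset_def LPMs_eq)
  then show ?case
    by (intro bexI[of _ "{?M}"]) (auto simp: Chains_def)
next
  case (Suc k)
  let ?M' = "lpm n k (U - {Max U}) (L - {Max L})" and ?M = "lpm n (Suc k) U L"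
  note P' = remove_Max_quotient(1)[OF Suc.prems] and quot = remove_Max_quotient(2)[OF Suc.prems]
  obtain C where C: "C \<in> Chains (LPM_poset n)" "\<forall>M\<in>C. (M, ?M') \<in> LPM_poset n" "finite C"
      "card C = Suc k"
    using Suc.IH[OF P'] by blast
  have M: "?M \<in> LPMs n"
    using Suc.prems by (auto simp: LPMs_eq)
  have below: "\<forall>N\<in>insert ?M C. (N, ?M) \<in> LPM_poset n"
    using C(2) M quot quotient_le_refl quotient_le_trans
    unfolding LPM_poset_def by blast
  have "?M \<notin> C"
  proof
    assume "?M \<in> C"
    then have "?M \<le>\<^sub>Q ?M'" using C(2) by (auto simp: LPM_poset_def)
    then show False
      using quotient_rank_le[OF Suc.prems P'] by simp
  qed
  moreover have "insert ?M C \<in> Chains (LPM_poset n)"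
    using C(1) below unfolding Chains_def by blast
  ultimately show ?case
    using below C(3,4) by (intro bexI[of _ "insert ?M C"]) auto
qed

text \<open>The ranks as matroids separate the elements of a chain, because two of them are comparable
  and equal rank would force them to coincide; below \<open>lpm n k U L\<close> only the \<open>k + 1\<close> values
  \<open>0, \<dots>, k\<close> are possible.\<close>

lemma chain_below_card_le:
  assumes P: "(U, L) \<in> gale_pairs n k"
    and chain: "C \<in> Chains (LPM_poset n)"
    and below: "\<forall>M\<in>C. (M, lpm n k U L) \<in> LPM_poset n"
  shows "card C \<le> Suc k"
proof -
  have "\<exists>i U' L'. (U', L') \<in> gale_pairs n i \<and> M = lpm n i U' L' \<and> i \<le> k" if M: "M \<in> C" for M
  proof -
    obtain i U' L' where *: "(U', L') \<in> gale_pairs n i" "M = lpm n i U' L'" "M \<le>\<^sub>Q lpm n k U L"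
      using bspec[OF below M] by (auto simp: LPM_poset_def LPMs_eq)
    then show ?thesis using quotient_rank_le[OF _ P] by blast
  qed
  then obtain r where r: "\<And>M. M \<in> C \<Longrightarrow>
      \<exists>U' L'. (U', L') \<in> gale_pairs n (r M) \<and> M = lpm n (r M) U' L' \<and> r M \<le> k"
    by metis
  have same: "M = N" if "M \<in> C" "N \<in> C" "r M = r N" "M \<le>\<^sub>Q N" for M N
    using r[OF that(1)] r[OF that(2)] that(3,4) same_rank_quotient_eq by metis
  have "inj_on r C"
  proof
    fix M N assume MN: "M \<in> C" "N \<in> C" "r M = r N"
    then have "M \<le>\<^sub>Q N \<or> N \<le>\<^sub>Q M"
      using chain unfolding Chains_def LPM_poset_def by blast
    then show "M = N" using same MN by metis
  qed
  moreover have "r ` C \<subseteq> {..k}" using r by blast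
  ultimately show ?thesis
    using card_inj_on_le[of r C "{..k}"] by simp
qed

lemma poset_rank_lpm:
  assumes P: "(U, L) \<in> gale_pairs n k"
  shows "poset_rank (LPM_poset n) (lpm n k U L) = k"
proof -
  let ?S = "{card C | C. C \<in> Chains (LPM_poset n) \<and>
    (\<forall>M\<in>C. (M, lpm n k U L) \<in> LPM_poset n)}"
  have bound: "s \<le> Suc k" if "s \<in> ?S" for s
    using that chain_below_card_le[OF P] by blast
  then have "finite ?S" by (meson finite_nat_set_iff_bounded_le)
  moreover have "Suc k \<in> ?S"
    using maximal_chain_below[OF P] by (smt (verit) mem_Collect_eq)
  ultimately have "Max ?S = Suc k"
    using bound by (intro Max_eqI) auto
  then show ?thesis by (simp add: poset_rank_def)
qed

section \<open>Counting dominated pairs\<close>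

definition dominated_pairs :: "nat \<Rightarrow> nat \<Rightarrow> nat \<Rightarrow> (nat set \<times> nat set) set" where
  "dominated_pairs n a b = {(A, B). A \<subseteq> {1..n} \<and> B \<subseteq> {1..n} \<and> card A = a \<and> card B = b \<and>
     dominates A B}"

lemma card_filtered_Pow_Suc:
  "card {(A, B). A \<subseteq> {1..Suc n} \<and> B \<subseteq> {1..Suc n} \<and> Q A B} =
     card {(A, B). A \<subseteq> {1..n} \<and> B \<subseteq> {1..n} \<and> Q A B} +
     card {(A, B). A \<subseteq> {1..n} \<and> B \<subseteq> {1..n} \<and> Q (insert (Suc n) A) B} +
     card {(A, B). A \<subseteq> {1..n} \<and> B \<subseteq> {1..n} \<and> Q A (insert (Suc n) B)} +
     card {(A, B). A \<subseteq> {1..n} \<and> B \<subseteq> {1..n} \<and> Q (insert (Suc n) A) (insert (Suc n) B)}"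
proof -
  have as_sum: "card {(A, B). A \<subseteq> {1..m} \<and> B \<subseteq> {1..m} \<and> R A B} =
      (\<Sum>A\<in>Pow {1..m}. \<Sum>B\<in>Pow {1..m}. of_bool (R A B))" for m and R :: "nat set \<Rightarrow> nat set \<Rightarrow> bool"
  proof -
    have "{(A, B). A \<subseteq> {1..m} \<and> B \<subseteq> {1..m} \<and> R A B} =
        (SIGMA A:Pow {1..m}. Pow {1..m} \<inter> {B. R A B})" by auto
    then show ?thesis
      by (simp add: of_bool_def sum.If_cases)
  qed
  have split: "sum f (Pow {1..Suc n}) = (\<Sum>A\<in>Pow {1..n}. f A + f (insert (Suc n) A))"
    for f :: "nat set \<Rightarrow> nat"
  proof -
    have "Pow {1..Suc n} = Pow {1..n} \<union> insert (Suc n) ` Pow {1..n}"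
      using Pow_insert[of "Suc n" "{1..n}"] by (simp add: atLeastAtMostSuc_conv)
    then have "sum f (Pow {1..Suc n}) = sum f (Pow {1..n}) + sum f (insert (Suc n) ` Pow {1..n})"
      by (simp only:) (intro sum.union_disjoint, auto)
    also have "sum f (insert (Suc n) ` Pow {1..n}) = (\<Sum>A\<in>Pow {1..n}. f (insert (Suc n) A))"
    proof (rule sum.reindex_cong[OF _ refl refl])
      show "inj_on (insert (Suc n)) (Pow {1..n})"
        unfolding inj_on_def
        by (metis PowD Suc_n_not_le_n atLeastAtMost_iff insert_ident subsetD)
    qed
    finally show ?thesis by (simp add: sum.distrib)
  qed
  show ?thesis
    unfolding as_sum split by (simp add: sum.distrib)
qed

text \<open>Prefix counts up to \<open>n\<close> do not see the element \<open>n + 1\<close>, and beyond \<open>n\<close> they are the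
  cardinalities, so this element adds the single condition \<open>card B \<le> card A\<close>.\<close>

lemma dominates_Suc_iff:
  assumes "A \<subseteq> {1..Suc n}" "B \<subseteq> {1..Suc n}"
  shows "dominates A B \<longleftrightarrow> dominates (A - {Suc n}) (B - {Suc n}) \<and> card B \<le> card A"
proof -
  have low: "prefix_card (X - {Suc n}) j = prefix_card X (min j n)" if "X \<subseteq> {1..Suc n}" for X j
  proof -
    have "(X - {Suc n}) \<inter> {..j} = X \<inter> {..min j n}"
      using that by fastforce
    then show ?thesis by (simp add: prefix_card_def)
  qed
  have high: "prefix_card X j = card X" if "X \<subseteq> {1..Suc n}" "n < j" for X j
    using that by (intro prefix_card_eq_card) fastforce
  show ?thesis
    unfolding dominates_def using low[OF assms(1)] low[OF assms(2)]
      high[OF assms(1)] high[OF assms(2)]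
    by (metis lessI linorder_not_less min.absorb1 min.cobounded2 min_def)
qed

text \<open>For \<open>b \<le> a\<close> the condition that the element \<open>n + 1\<close> adds holds automatically, and the four
  terms are the four ways in which it can lie in \<open>A\<close> and \<open>B\<close>; the zeros stand for sets of
  negative size.\<close>

lemma card_dominated_pairs_Suc:
  assumes "b \<le> a"
  shows "card (dominated_pairs (Suc n) a b) =
    card (dominated_pairs n a b) +
    (case a of 0 \<Rightarrow> 0 | Suc a' \<Rightarrow> card (dominated_pairs n a' b)) +
    (case b of 0 \<Rightarrow> 0 | Suc b' \<Rightarrow> card (dominated_pairs n a b')) +
    (case a of 0 \<Rightarrow> 0 | Suc a' \<Rightarrow> case b of 0 \<Rightarrow> 0 | Suc b' \<Rightarrow> card (dominated_pairs n a' b'))"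
proof -
  have dom: "card A = a \<Longrightarrow> card B = b \<Longrightarrow> dominates A B \<longleftrightarrow>
      dominates (A - {Suc n}) (B - {Suc n})"
    if "A \<subseteq> {1..Suc n}" "B \<subseteq> {1..Suc n}" for A B
    using dominates_Suc_iff[OF that] assms by simp
  have new: "finite X \<and> Suc n \<notin> X \<and> X - {Suc n} = X \<and> X \<subseteq> {1..Suc n} \<and>
      insert (Suc n) X \<subseteq> {1..Suc n} \<and> insert (Suc n) X - {Suc n} = X"
    if "X \<subseteq> {1..n}" for X
    using that finite_subset[OF that] by force
  let ?Q = "\<lambda>A B. card A = a \<and> card B = b \<and> dominates A B"
  have "{(A, B). A \<subseteq> {1..n} \<and> B \<subseteq> {1..n} \<and> ?Q (insert (Suc n) A) B} =
      (case a of 0 \<Rightarrow> {} | Suc a' \<Rightarrow> dominated_pairs n a' b)"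
    using dom new by (auto simp: dominated_pairs_def split: nat.split)
  moreover have "{(A, B). A \<subseteq> {1..n} \<and> B \<subseteq> {1..n} \<and> ?Q A (insert (Suc n) B)} =
      (case b of 0 \<Rightarrow> {} | Suc b' \<Rightarrow> dominated_pairs n a b')"
    using dom new by (auto simp: dominated_pairs_def split: nat.split)
  moreover have "{(A, B). A \<subseteq> {1..n} \<and> B \<subseteq> {1..n} \<and> ?Q (insert (Suc n) A) (insert (Suc n) B)} =
      (case a of 0 \<Rightarrow> {} | Suc a' \<Rightarrow> case b of 0 \<Rightarrow> {} | Suc b' \<Rightarrow> dominated_pairs n a' b')"
    using dom new by (auto simp: dominated_pairs_def split: nat.split)
  ultimately show ?thesis
    unfolding dominated_pairs_def card_filtered_Pow_Suc[of n ?Q]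
    by (simp split: nat.split)
qed

lemma dominated_pairs_empty:
  assumes "a < b"
  shows "dominated_pairs n a b = {}"
proof -
  have le: "card B \<le> card A" if "A \<subseteq> {1..n}" "B \<subseteq> {1..n}" "dominates A B" for A B
  proof -
    have "A \<subseteq> {..n}" "B \<subseteq> {..n}" using that by auto
    then show ?thesis using that(3) by (metis dominates_def prefix_card_eq_card)
  qed
  have False if "(A, B) \<in> dominated_pairs n a b" for A B
    using that le[of A B] assms by (auto simp: dominated_pairs_def)
  then show ?thesis by auto
qed

text \<open>The two-by-two determinant that the reflection principle predicts for pairs of non-crossing
  paths. Both sides satisfy the same four-term recursion, for the right-hand side by Pascal's rule
  alone; and on the boundary \<open>b = a + 1\<close>, where there are no dominated pairs, the two products
  cancel. This boundary has to be included because the recursion reaches it from \<open>a = b\<close>. The case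
  \<open>b = 0\<close> reads the binomial coefficient \<open>C(n, -1)\<close> as 0.\<close>

lemma card_dominated_pairs:
  assumes "b \<le> Suc a"
  shows "int (card (dominated_pairs n a b)) = int (n choose a) * int (n choose b) -
    int (n choose Suc a) * (case b of 0 \<Rightarrow> 0 | Suc b' \<Rightarrow> int (n choose b'))"
  using assms
proof (induction n arbitrary: a b)
  case 0
  have "dominated_pairs 0 a b = (if a = 0 \<and> b = 0 then {({}, {})} else {})"
    by (auto simp: dominated_pairs_def dominates_refl)
  then show ?case by (auto split: nat.split)
next
  case (Suc n)
  show ?case
  proof (cases "b = Suc a")
    case True
    then show ?thesis using dominated_pairs_empty[of a b] by simp
  next
    case False
    then have "b \<le> a" using Suc.prems by simp
    show ?thesis
      unfolding card_dominated_pairs_Suc[OF \<open>b \<le> a\<close>] using \<open>b \<le> a\<close>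
      by (cases a; cases b) (auto simp: Suc.IH algebra_simps split: nat.split)
  qed
qed

text \<open>With \<open>x = C(n, k)\<close> and \<open>d = n - k\<close>, all binomial coefficients involved are rational multiples
  of \<open>x\<close>, and both sides become \<open>x\<^sup>2 (n + 1) / ((k + 1) (d + 1))\<close>.\<close>

lemma narayana_eq_determinant:
  assumes "k \<le> n"
  shows "narayana (n + 1) (n - k + 1) = of_nat (n choose k) * of_nat (n choose k) -
    of_nat (n choose Suc k) * (case k of 0 \<Rightarrow> 0 | Suc k' \<Rightarrow> of_nat (n choose k'))"
proof (cases k)
  case 0
  then show ?thesis by (simp add: narayana_def)
next
  case (Suc j)
  obtain d where n: "n = k + d" using assms le_Suc_ex by blast
  define x :: rat where "x = of_nat (n choose k)"
  have k0: "of_nat k + 1 \<noteq> (0::rat)" "of_nat d + 1 \<noteq> (0::rat)" "of_nat n + 1 \<noteq> (0::rat)"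
    using of_nat_neq_0[where 'a = rat] by (simp_all add: add.commute)
  have c1: "of_nat (n choose Suc k) = of_nat d * x / (of_nat k + 1)"
  proof -
    have "Suc k * (n choose Suc k) = d * (n choose k)"
      using binomial_absorb_comp[of n k] binomial_absorption[of k n] n by simp
    from arg_cong[OF this, of "of_nat :: nat \<Rightarrow> rat"] show ?thesis
      using k0 by (simp add: field_simps x_def)
  qed
  have c2: "of_nat (n choose j) = of_nat k * x / (of_nat d + 1)"
  proof -
    have "Suc d * (n choose j) = k * (n choose k)"
      using binomial_absorb_comp[of n j] binomial_absorption[of j n] n Suc by simp
    from arg_cong[OF this, of "of_nat :: nat \<Rightarrow> rat"] show ?thesis
      using k0 by (simp add: field_simps x_def)
  qed
  have c3: "of_nat (Suc n choose Suc k) = (of_nat n + 1) * x / (of_nat k + 1)"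
  proof -
    have "Suc k * (Suc n choose Suc k) = Suc n * (n choose k)"
      by (rule Suc_times_binomial)
    from arg_cong[OF this, of "of_nat :: nat \<Rightarrow> rat"] show ?thesis
      using k0 unfolding of_nat_mult of_nat_Suc by (simp add: field_simps x_def del: binomial_Suc_Suc)
  qed
  have c4: "of_nat (Suc n choose k) = (of_nat n + 1) * x / (of_nat d + 1)"
  proof -
    have "Suc d * (Suc n choose k) = Suc n * (n choose k)"
      using binomial_absorb_comp[of "Suc n" k] n by simp
    from arg_cong[OF this, of "of_nat :: nat \<Rightarrow> rat"] show ?thesis
      using k0 unfolding of_nat_mult of_nat_Suc by (simp add: field_simps x_def del: binomial_Suc_Suc)
  qed
  have sym: "Suc n choose Suc d = Suc n choose k" "Suc n choose d = Suc n choose Suc k"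
    using binomial_symmetric[of k "Suc n"] binomial_symmetric[of "Suc k" "Suc n"] n by simp_all
  have "narayana (n + 1) (n - k + 1) =
      1 / (of_nat n + 1) * of_nat (Suc n choose k) * of_nat (Suc n choose Suc k)"
    using n sym by (simp add: narayana_def add.commute)
  also have "\<dots> = x * x - of_nat d * x / (of_nat k + 1) * (of_nat k * x / (of_nat d + 1))"
    unfolding c3 c4 using k0 n by (simp add: divide_simps) (simp add: algebra_simps)
  finally show ?thesis
    using Suc c1 c2 by (simp add: x_def)
qed

lemma card_gale_pairs:
  assumes "k \<le> n"
  shows "of_nat (card (gale_pairs n k)) = narayana (n + 1) (n - k + 1)"
proof -
  have "gale_pairs n k = dominated_pairs n k k"
  proof -
    have "X \<in> [{1..n}]\<^bsup>k\<^esup> \<longleftrightarrow> X \<subseteq> {1..n} \<and> card X = k" for X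
      using finite_subset[of X "{1..n}"] by (auto simp: nsets_def)
    then show ?thesis
      by (simp add: set_eq_iff split_paired_All gale_pairs_iff dominated_pairs_def conj_ac)
  qed
  then have "of_int (int (card (gale_pairs n k))) = narayana (n + 1) (n - k + 1)"
    unfolding narayana_eq_determinant[OF assms]
    by (simp only: card_dominated_pairs[of k k n, simplified]) (simp split: nat.split)
  then show ?thesis by simp
qed

theorem corollary22:
  fixes n z :: nat
  assumes "z \<le> n"
  shows "of_nat (card {M \<in> LPMs n. poset_rank (LPM_poset n) M = n - z}) = narayana (n + 1) (z + 1)"
proof -
  define k where "k = n - z"
  have k: "k \<le> n" "n - k = z" using assms by (auto simp: k_def)
  have "{M \<in> LPMs n. poset_rank (LPM_poset n) M = k} = (\<lambda>(U, L). lpm n k U L) ` gale_pairs n k"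
    using poset_rank_lpm by (fastforce simp: LPMs_eq)
  moreover have "inj_on (\<lambda>(U, L). lpm n k U L) (gale_pairs n k)"
  proof (rule inj_onI, clarify)
    fix U L U' L'
    assume "(U, L) \<in> gale_pairs n k" "(U', L') \<in> gale_pairs n k" "lpm n k U L = lpm n k U' L'"
    then show "U = U' \<and> L = L'" using ends_eq_if_bases_eq by metis
  qed
  ultimately have "card {M \<in> LPMs n. poset_rank (LPM_poset n) M = k} = card (gale_pairs n k)"
    by (simp add: card_image)
  then show ?thesis
    using card_gale_pairs[OF k(1)] k(2) by (simp add: k_def)
qed

end
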